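(* Let $\lambda,\lambda'\in\mathbb{C}^*$, $\alpha,\alpha',\beta,\beta',\gamma,\gamma'\in\mathbb{C}$ and $h(t),q(t)\in\mathbb{C}[t]$. Then $\Phi(\lambda,\alpha,\beta,\gamma,h(t))\cong\Phi(\lambda',\alpha',\beta',\gamma',q(t))$ as $\mathfrak{L}$-modules if and only if $(\lambda,\alpha,\beta,\gamma,h(t))=(\lambda',\alpha',\beta',\gamma',q(t))$.
   Context: All vector spaces are over $\mathbb{C}$; $\mathbb{C}^*$ is the set of nonzero complex numbers. The BMS-Kac-Moody algebra $\mathfrak{L}$ is the complex Lie algebra with basis $\{L_m,M_m,S_m,I_m\mid m\in\mathbb{Z}\}$ and nontrivial brackets, for all $m,n\in\mathbb{Z}$, $$[L_m,L_n]=(n-m)L_{m+n},\quad [L_m,M_n]=(n-m)M_{m+n},\quad [L_m,S_n]=nS_{m+n},$$ $$[L_m,I_n]=nI_{m+n},\quad [M_m,I_n]=-nS_{m+n}$$ (all other brackets between basis elements, apart from those determined by skew-symmetry, are zero). For $\lambda\in\mathbb{C}^*$, $\alpha,\beta,\gamma\in\mathbb{C}$ and $h(t)\in\mathbb{C}[t]$, set for $m\in\mathbb{Z}$ $$h_m(t)=m h(t)-m(m-1)\alpha\frac{h(t)-h(\alpha)}{t-\alpha}\in\mathbb{C}[t].$$ The $\mathfrak{L}$-module $\Phi(\lambda,\alpha,\beta,\gamma,h(t))$ is the vector space $\mathbb{C}[s,t]$ with the action, for $f(s,t)\in\mathbb{C}[s,t]$ and $m\in\mathbb{Z}$, $$L_m\cdot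 f(s,t)=\lambda^m(s+h_m(t))f(s-m,t)-m\lambda^m(t-m\alpha)\frac{\partial}{\partial t}\big(f(s-m,t)\big),$$ $$M_m\cdot f(s,t)=\lambda^m(t-m\alpha)f(s-m,t),\qquad S_m\cdot f(s,t)=\lambda^m\beta f(s-m,t),$$ $$I_m\cdot f(s,t)=\lambda^m\Big(\gamma-m\beta\frac{h(t)-h(\alpha)}{t-\alpha}\Big)f(s-m,t)+m\lambda^m\beta\frac{\partial}{\partial t}\big(f(s-m,t)\big).$$ *)

theory Defs
  imports Complex_Main "HOL-Library.Poly_Mapping" "HOL-Computational_Algebra.Polynomial"
begin

section \<open>Complex Lie algebras and their modules\<close>

locale lie_algebra = vector_space scale
  for scale :: "complex \<Rightarrow> 'g::ab_group_add \<Rightarrow> 'g" +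
  fixes bracket :: "'g \<Rightarrow> 'g \<Rightarrow> 'g"
  assumes linear_bracket_right: "Vector_Spaces.linear scale scale (\<lambda>y. bracket x y)"
    and linear_bracket_left: "Vector_Spaces.linear scale scale (\<lambda>x. bracket x y)"
    and bracket_self: "bracket x x = 0"
    and jacobi: "bracket x (bracket y z) + bracket y (bracket z x) + bracket z (bracket x y) = 0"

locale lie_module = lie_algebra gscale bracket + V: vector_space vscale
  for gscale :: "complex \<Rightarrow> 'g::ab_group_add \<Rightarrow> 'g"
    and bracket :: "'g \<Rightarrow> 'g \<Rightarrow> 'g"
    and vscale :: "complex \<Rightarrow> 'v::ab_group_add \<Rightarrow> 'v" +
  fixes act :: "'g \<Rightarrow> 'v \<Rightarrow> 'v"
  assumes linear_act_right: "Vector_Spaces.linear vscale vscale (\<lambda>v. act x v)"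
    and linear_act_left: "Vector_Spaces.linear gscale vscale (\<lambda>x. act x v)"
    and act_bracket: "act (bracket x y) v = act x (act y v) - act y (act x v)"

definition lie_module_isomorphic ::
  "(complex \<Rightarrow> 'g::ab_group_add \<Rightarrow> 'g) \<Rightarrow> ('g \<Rightarrow> 'g \<Rightarrow> 'g)
    \<Rightarrow> (complex \<Rightarrow> 'v::ab_group_add \<Rightarrow> 'v) \<Rightarrow> ('g \<Rightarrow> 'v \<Rightarrow> 'v)
    \<Rightarrow> (complex \<Rightarrow> 'w::ab_group_add \<Rightarrow> 'w) \<Rightarrow> ('g \<Rightarrow> 'w \<Rightarrow> 'w) \<Rightarrow> bool"
  where "lie_module_isomorphic gscale bracket vscale act wscale act' \<longleftrightarrow>
    lie_module gscale bracket vscale act \<and> lie_module gscale bracket wscale act' \<and>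
    (\<exists>\<phi>. Vector_Spaces.linear vscale wscale \<phi> \<and> bij \<phi> \<and>
         (\<forall>x v. \<phi> (act x v) = act' x (\<phi> v)))"

text \<open>The linear map on the free vector space that sends the basis vector of index \<open>k\<close> to \<open>b k\<close>.\<close>

definition linear_extension ::
  "(complex \<Rightarrow> 'v::ab_group_add \<Rightarrow> 'v) \<Rightarrow> ('k \<Rightarrow> 'v) \<Rightarrow> ('k \<Rightarrow>\<^sub>0 complex) \<Rightarrow> 'v"
  where "linear_extension vscale b x =
    (\<Sum>k\<in>Poly_Mapping.keys x. vscale (Poly_Mapping.lookup x k) (b k))"


section \<open>The BMS-Kac-Moody algebra\<close>

datatype bms_index = L int | M int | S int | I int

text \<open>The algebra is the free complex vector space on the symbols \<open>L m\<close>, \<open>M m\<close>, \<open>S m\<close>, \<open>I m\<close>; the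
  basis vector belonging to \<open>k\<close> is \<open>Poly_Mapping.single k 1\<close>.\<close>

type_synonym bms = "bms_index \<Rightarrow>\<^sub>0 complex"

definition bms_scale :: "complex \<Rightarrow> bms \<Rightarrow> bms"
  where "bms_scale c = Poly_Mapping.map ((*) c)"

fun bms_bracket_basis :: "bms_index \<Rightarrow> bms_index \<Rightarrow> bms" where
  "bms_bracket_basis (L m) (L n) = Poly_Mapping.single (L (m + n)) (of_int (n - m))"
| "bms_bracket_basis (L m) (M n) = Poly_Mapping.single (M (m + n)) (of_int (n - m))"
| "bms_bracket_basis (L m) (S n) = Poly_Mapping.single (S (m + n)) (of_int n)"
| "bms_bracket_basis (L m) (I n) = Poly_Mapping.single (I (m + n)) (of_int n)"
| "bms_bracket_basis (M m) (I n) = Poly_Mapping.single (S (m + n)) (of_int (- n))"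
| "bms_bracket_basis (M m) (L n) = - Poly_Mapping.single (M (n + m)) (of_int (m - n))"
| "bms_bracket_basis (S m) (L n) = - Poly_Mapping.single (S (n + m)) (of_int m)"
| "bms_bracket_basis (I m) (L n) = - Poly_Mapping.single (I (n + m)) (of_int m)"
| "bms_bracket_basis (I m) (M n) = - Poly_Mapping.single (S (n + m)) (of_int (- m))"
| "bms_bracket_basis _ _ = 0"

definition bms_bracket :: "bms \<Rightarrow> bms \<Rightarrow> bms"
  where "bms_bracket x y =
    linear_extension bms_scale (\<lambda>a. linear_extension bms_scale (bms_bracket_basis a) y) x"


section \<open>The modules \<open>\<Phi>(\<lambda>, \<alpha>, \<beta>, \<gamma>, h(t))\<close>\<close>

text \<open>An element of \<open>\<complex>[s, t]\<close> is a polynomial in \<open>s\<close> whose coefficients are polynomials in \<open>t\<close>.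
  So \<open>p(t)\<close> is \<open>[:p:]\<close>, the product \<open>p(t) f(s, t)\<close> is \<open>smult p f\<close>, and \<open>s + p(t)\<close> is \<open>[:p, 1:]\<close>.\<close>

type_synonym cst = "complex poly poly"

definition cst_scale :: "complex \<Rightarrow> cst \<Rightarrow> cst"
  where "cst_scale c f = smult [:c:] f"

text \<open>\<open>shift_s m f\<close> is \<open>f(s - m, t)\<close>.\<close>

definition shift_s :: "int \<Rightarrow> cst \<Rightarrow> cst"
  where "shift_s m f = pcompose f [:- of_int m, 1:]"

definition deriv_t :: "cst \<Rightarrow> cst"
  where "deriv_t f = map_poly pderiv f"

text \<open>\<open>(h(t) - h(\<alpha>)) / (t - \<alpha>)\<close>; the division is exact.\<close>

definition diff_quot :: "complex \<Rightarrow> complex poly \<Rightarrow> complex poly"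
  where "diff_quot \<alpha> h = (h - [:poly h \<alpha>:]) div [:- \<alpha>, 1:]"

definition h_seq :: "complex \<Rightarrow> complex poly \<Rightarrow> int \<Rightarrow> complex poly"
  where "h_seq \<alpha> h m = smult (of_int m) h - smult (of_int (m * (m - 1)) * \<alpha>) (diff_quot \<alpha> h)"

fun Phi_basis ::
  "complex \<Rightarrow> complex \<Rightarrow> complex \<Rightarrow> complex \<Rightarrow> complex poly \<Rightarrow> bms_index \<Rightarrow> cst \<Rightarrow> cst"
  where
  "Phi_basis lam \<alpha> \<beta> \<gamma> h (L m) f =
     cst_scale (lam powi m) ([:h_seq \<alpha> h m, 1:] * shift_s m f)
     - cst_scale (of_int m * lam powi m) (smult [:- (of_int m * \<alpha>), 1:] (deriv_t (shift_s m f)))"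
| "Phi_basis lam \<alpha> \<beta> \<gamma> h (M m) f =
     cst_scale (lam powi m) (smult [:- (of_int m * \<alpha>), 1:] (shift_s m f))"
| "Phi_basis lam \<alpha> \<beta> \<gamma> h (S m) f = cst_scale (lam powi m * \<beta>) (shift_s m f)"
| "Phi_basis lam \<alpha> \<beta> \<gamma> h (I m) f =
     cst_scale (lam powi m) (smult ([:\<gamma>:] - smult (of_int m * \<beta>) (diff_quot \<alpha> h)) (shift_s m f))
     + cst_scale (of_int m * lam powi m * \<beta>) (deriv_t (shift_s m f))"

definition Phi ::
  "complex \<Rightarrow> complex \<Rightarrow> complex \<Rightarrow> complex \<Rightarrow> complex poly \<Rightarrow> bms \<Rightarrow> cst \<Rightarrow> cst"
  where "Phi lam \<alpha> \<beta> \<gamma> h x f = linear_extension cst_scale (\<lambda>k. Phi_basis lam \<alpha> \<beta> \<gamma> h k f) x"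

end

theory Submission
  imports Defs
begin

text \<open>
  Isomorphisms are rigid because \<open>L\<^sub>0\<close> and \<open>M\<^sub>0\<close> act on \<open>\<complex>[s, t]\<close> as multiplication by \<open>s\<close> and by
  \<open>t\<close>. A module isomorphism \<open>\<phi>\<close> is therefore \<open>\<complex>[s, t]\<close>-linear, so it is multiplication by \<open>\<phi>(1)\<close>
  (\<open>additive_commuting_imp_mult\<close>). Surjectivity makes \<open>\<phi>(1)\<close> a unit of \<open>\<complex>[s, t]\<close>, a nonzero constant,
  and such a map can intertwine two actions only if they coincide on the polynomial \<open>1\<close>. The parameters
  are visible there: \<open>M\<^sub>1 \<cdot> 1 = \<lambda>(t - \<alpha>)\<close>, \<open>S\<^sub>0 \<cdot> 1 = \<beta>\<close>, \<open>I\<^sub>0 \<cdot> 1 = \<gamma>\<close> and \<open>L\<^sub>1 \<cdot> 1 = \<lambda>(s + h(t))\<close>.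

  For equal parameters the identity map is an isomorphism, but being isomorphic \<^emph>\<open>as modules\<close> includes that
  the bracket satisfies the Jacobi identity and that \<open>\<Phi>\<close> respects it. Both are multilinear statements
  about a free vector space and reduce to the basis (\<open>linear_eq_on_basis\<close>). For the module axiom, put
  \<open>g = (h(t) - h(\<alpha>)) / (t - \<alpha>)\<close>; then \<open>h\<^sub>m = m (h(\<alpha>) + (t - m\<alpha>) g)\<close>, and every basis element acts by a
  first-order differential operator in \<open>t\<close> combined with a shift in \<open>s\<close>,
  \<open>f \<mapsto> \<lambda>\<^sup>m ((e s + u(t)) f(s - m, t) + v(t) \<partial>\<^sub>t f(s - m, t))\<close>.
  Such operators are closed under commutators by one explicit formula (\<open>commutator_first_order\<close>), which
  turns each bracket relation into an identity between polynomials in \<open>t\<close> (\<open>Phi_bracket_basis\<close>).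
\<close>

section \<open>Linear maps out of a free vector space\<close>

lemma poly_mapping_induct_add [case_names single add]:
  fixes x :: "'k \<Rightarrow>\<^sub>0 'a::ab_group_add"
  assumes single: "\<And>k c. P (Poly_Mapping.single k c)"
    and add: "\<And>x y. P x \<Longrightarrow> P y \<Longrightarrow> P (x + y)"
  shows "P x"
proof (induction x rule: update_induct)
  case const
  show ?case using single[of undefined 0] by simp
next
  case (update f a b)
  have "Poly_Mapping.update a b f = Poly_Mapping.single a b + f"
    using update(1)
    by (intro poly_mapping_eqI)
      (auto simp: lookup_update lookup_add lookup_single when_def in_keys_iff)
  then show ?case using single update(3) by (simp add: add)
qed

lemma lookup_bms_scale [simp]:
  "Poly_Mapping.lookup (bms_scale c x) k = c * Poly_Mapping.lookup x k"
  by (simp add: bms_scale_def Poly_Mapping.map.rep_eq when_def)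

lemma bms_scale_single [simp]:
  "bms_scale c (Poly_Mapping.single k d) = Poly_Mapping.single k (c * d)"
  by (intro poly_mapping_eqI) (simp add: lookup_single when_def)

lemma vector_space_bms_scale: "vector_space bms_scale"
  by unfold_locales (auto intro!: poly_mapping_eqI simp: lookup_add algebra_simps)

interpretation bms: vector_space bms_scale
  by (rule vector_space_bms_scale)

lemma linear_extension_superset:
  assumes "vector_space s" "finite A" "Poly_Mapping.keys x \<subseteq> A"
  shows "linear_extension s b x = (\<Sum>k\<in>A. s (Poly_Mapping.lookup x k) (b k))"
proof -
  interpret vector_space s by fact
  show ?thesis
    unfolding linear_extension_def using assms(2,3)
    by (intro sum.mono_neutral_left) (auto simp: in_keys_iff)
qed

lemma linear_extension_single:
  assumes "vector_space s"
  shows "linear_extension s b (Poly_Mapping.single k c) = s c (b k)"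
proof -
  interpret vector_space s by fact
  show ?thesis
    using linear_extension_superset[OF assms, of "{k}" "Poly_Mapping.single k c" b] by simp
qed

lemma linear_extension_add:
  assumes "vector_space s"
  shows "linear_extension s b (x + y) = linear_extension s b x + linear_extension s b y"
proof -
  interpret vector_space s by fact
  let ?A = "Poly_Mapping.keys x \<union> Poly_Mapping.keys y"
  have "linear_extension s b z = (\<Sum>k\<in>?A. s (Poly_Mapping.lookup z k) (b k))"
    if "Poly_Mapping.keys z \<subseteq> ?A" for z
    using that by (intro linear_extension_superset[OF assms]) auto
  then show ?thesis
    by (simp add: keys_add lookup_add scale_left_distrib sum.distrib)
qed

lemma linear_extension_scale:
  assumes "vector_space s"
  shows "linear_extension s b (bms_scale c x) = s c (linear_extension s b x)"
proof -
  interpret vector_space s by fact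
  have "Poly_Mapping.keys (bms_scale c x) \<subseteq> Poly_Mapping.keys x"
    by (auto simp: in_keys_iff)
  then have "linear_extension s b (bms_scale c x) =
      (\<Sum>k\<in>Poly_Mapping.keys x. s (c * Poly_Mapping.lookup x k) (b k))"
    by (subst linear_extension_superset[OF assms, of "Poly_Mapping.keys x"]) auto
  then show ?thesis
    by (simp add: linear_extension_def scale_sum_right)
qed

lemma linear_linear_extension:
  assumes "vector_space s"
  shows "Vector_Spaces.linear bms_scale s (linear_extension s b)"
  using assms by (simp add: Vector_Spaces.linear_iff vector_space_bms_scale
      linear_extension_add linear_extension_scale)

text \<open>
  Identities that are linear in an element of the Lie algebra, such as the Jacobi identity in each
  argument or the module axiom, become finite case distinctions through this principle.
\<close>
lemma linear_eq_on_basis: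
  assumes F: "Vector_Spaces.linear bms_scale s F" and G: "Vector_Spaces.linear bms_scale s G"
    and basis: "\<And>k. F (Poly_Mapping.single k 1) = G (Poly_Mapping.single k 1)"
  shows "F x = G x"
proof (induction x rule: poly_mapping_induct_add)
  case (single k c)
  have "H (Poly_Mapping.single k c) = s c (H (Poly_Mapping.single k 1))"
    if "Vector_Spaces.linear bms_scale s H" for H
    using that bms_scale_single[of c k 1] by (metis Vector_Spaces.linear_iff mult.right_neutral)
  from this[OF F] this[OF G] show ?case by (simp add: basis)
next
  case (add x y)
  then show ?case using F G by (simp add: Vector_Spaces.linear_iff)
qed


section \<open>The Lie algebra\<close>

lemma bms_bracket_single:
  "bms_bracket (Poly_Mapping.single a c) (Poly_Mapping.single b d) =
    bms_scale (c * d) (bms_bracket_basis a b)"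
  by (simp add: bms_bracket_def linear_extension_single vector_space_bms_scale)

lemma bms_bracket_add_left: "bms_bracket (x + y) z = bms_bracket x z + bms_bracket y z"
  by (simp add: bms_bracket_def linear_extension_add vector_space_bms_scale)

lemma bms_bracket_scale_left: "bms_bracket (bms_scale c x) z = bms_scale c (bms_bracket x z)"
  by (simp add: bms_bracket_def linear_extension_scale vector_space_bms_scale)

lemma bms_bracket_add_right: "bms_bracket z (x + y) = bms_bracket z x + bms_bracket z y"
  by (simp add: bms_bracket_def linear_extension_add vector_space_bms_scale)
    (simp add: linear_extension_def bms.scale_right_distrib sum.distrib)

lemma bms_bracket_scale_right: "bms_bracket z (bms_scale c x) = bms_scale c (bms_bracket z x)"
  by (simp add: bms_bracket_def linear_extension_scale vector_space_bms_scale)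
    (simp add: linear_extension_def bms.scale_sum_right mult_ac)

lemma bms_bracket_zero [simp]: "bms_bracket x 0 = 0"
  using bms_bracket_scale_right[of x 0 0] by simp

lemmas bms_bracket_bilinear =
  bms_bracket_add_left bms_bracket_scale_left bms_bracket_add_right bms_bracket_scale_right

lemma bms_bracket_basis_skew: "bms_bracket_basis b a = - bms_bracket_basis a b"
  by (cases a; cases b) (simp_all add: single_uminus[symmetric] add.commute)

lemma bms_bracket_skew: "bms_bracket y x = - bms_bracket x y"
proof -
  have *: "bms_bracket y (Poly_Mapping.single a 1) = - bms_bracket (Poly_Mapping.single a 1) y"
    for a y
    by (rule linear_eq_on_basis[where s = bms_scale])
      (simp_all add: Vector_Spaces.linear_iff vector_space_bms_scale bms_bracket_bilinear
        bms_bracket_single bms_bracket_basis_skew[of _ a])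
  show ?thesis
    by (rule linear_eq_on_basis[where s = bms_scale and x = x])
      (simp_all add: Vector_Spaces.linear_iff vector_space_bms_scale bms_bracket_bilinear *)
qed

lemma bms_bracket_self: "bms_bracket x x = 0"
proof -
  have "bms_bracket x x = - bms_bracket x x"
    by (rule bms_bracket_skew)
  then have "Poly_Mapping.lookup (bms_bracket x x) k = - Poly_Mapping.lookup (bms_bracket x x) k" for k
    by (metis lookup_uminus)
  then show ?thesis
    by (intro poly_mapping_eqI) simp
qed

text \<open>
  In each of the 64 cases the three terms are multiples of one basis vector, and
  their coefficients cancel as polynomials in the indices.
\<close>
lemma bms_jacobi_basis:
  fixes a b c :: bms_index
  defines "e \<equiv> \<lambda>k::bms_index. Poly_Mapping.single k (1::complex)"
  shows "bms_bracket (e a) (bms_bracket (e b) (e c)) + bms_bracket (e b) (bms_bracket (e c) (e a))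
    + bms_bracket (e c) (bms_bracket (e a) (e b)) = 0"
  unfolding e_def
  by (cases a; cases b; cases c)
    (simp_all add: bms_bracket_single single_uminus[symmetric] single_add[symmetric] add_ac,
     simp_all add: algebra_simps)

lemma bms_jacobi:
  "bms_bracket x (bms_bracket y z) + bms_bracket y (bms_bracket z x)
    + bms_bracket z (bms_bracket x y) = 0"
proof -
  define J where "J x y z = bms_bracket x (bms_bracket y z) + bms_bracket y (bms_bracket z x)
    + bms_bracket z (bms_bracket x y)" for x y z
  have lin: "Vector_Spaces.linear bms_scale bms_scale (\<lambda>x. J x y z)" for y z
    by (simp add: J_def Vector_Spaces.linear_iff vector_space_bms_scale bms_bracket_bilinear
        bms.scale_right_distrib)
  have zero: "Vector_Spaces.linear bms_scale bms_scale (\<lambda>x. 0)"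
    by (simp add: Vector_Spaces.linear_iff vector_space_bms_scale)
  \<comment> \<open>Cyclic invariance moves the argument that is to be made general into the first position, so
    that linearity in the first argument suffices.\<close>
  have cyc: "J x y z = J y z x" for x y z
    by (simp add: J_def)
  let ?e = "\<lambda>k::bms_index. Poly_Mapping.single k (1::complex)"
  have "J (?e a) (?e b) (?e c) = 0" for a b c
    unfolding J_def by (rule bms_jacobi_basis)
  then have *: "J x (?e b) (?e c) = 0" for x b c
    by (rule linear_eq_on_basis[OF lin zero])
  have **: "J y (?e c) x = 0" for x y c
    by (rule linear_eq_on_basis[OF lin zero]) (subst cyc, subst cyc, rule *)
  have "J x y z = 0" for x y z
    by (rule linear_eq_on_basis[OF lin zero]) (subst cyc, subst cyc, rule **)
  then show ?thesis unfolding J_def .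
qed

lemma lie_algebra_bms: "lie_algebra bms_scale bms_bracket"
  by unfold_locales
    (simp_all add: Vector_Spaces.linear_iff vector_space_bms_scale bms_bracket_bilinear
      bms_bracket_self bms_jacobi)

section \<open>The ring \<open>\<complex>[s, t]\<close> with shift and derivation\<close>

text \<open>
  The ring \<open>\<complex>[s, t]\<close> is generated by the image of \<open>lift_t\<close> together with \<open>var_s\<close>. Writing all
  scalars and coefficients through them turns \<open>smult\<close> and \<open>cst_scale\<close> into ring multiplication, so that
  identities between operators can be settled by commutative ring normalisation.
\<close>

definition lift_t :: "complex poly \<Rightarrow> cst"
  where "lift_t p = [:p:]"

definition var_s :: cst
  where "var_s = [:0, 1:]"

lemma lift_t_ring_hom:
  "lift_t (p + q) = lift_t p + lift_t q" "lift_t (p - q) = lift_t p - lift_t q"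
  "lift_t (- p) = - lift_t p"
  "lift_t (p * q) = lift_t p * lift_t q" "lift_t 0 = 0" "lift_t 1 = 1"
  by (simp_all add: lift_t_def one_pCons)

lemma lift_t_one: "lift_t [:1:] = 1"
  by (simp add: lift_t_def one_pCons)

lemma lift_t_of_int: "lift_t [:of_int m:] = of_int m" "lift_t (of_int m) = of_int m"
  by (simp_all add: lift_t_def of_int_poly)

lemma shift_s_ring_hom:
  "shift_s m (f + g) = shift_s m f + shift_s m g"
  "shift_s m (f - g) = shift_s m f - shift_s m g"
  "shift_s m (f * g) = shift_s m f * shift_s m g"
  by (simp_all add: shift_s_def pcompose_add pcompose_diff pcompose_mult)

lemma shift_s_lift_t: "shift_s m (lift_t p) = lift_t p"
  by (simp add: shift_s_def lift_t_def)

lemma shift_s_of_int: "shift_s m (of_int n) = of_int n"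
  by (metis lift_t_of_int(1) shift_s_lift_t)

lemma shift_s_var_s: "shift_s m var_s = var_s - of_int m"
  by (simp add: shift_s_def var_s_def pcompose_pCons of_int_poly)

lemma shift_s_shift_s: "shift_s m (shift_s n f) = shift_s (m + n) f"
  by (simp add: shift_s_def pcompose_assoc[symmetric] pcompose_pCons algebra_simps)

lemma shift_s_0: "shift_s 0 f = f"
  by (simp add: shift_s_def)

lemma deriv_t_add: "deriv_t (f + g) = deriv_t f + deriv_t g"
  by (intro poly_eqI) (simp add: deriv_t_def coeff_map_poly pderiv_add)

lemma deriv_t_diff: "deriv_t (f - g) = deriv_t f - deriv_t g"
  by (intro poly_eqI) (simp add: deriv_t_def coeff_map_poly pderiv_diff)

lemma deriv_t_mult: "deriv_t (f * g) = deriv_t f * g + f * deriv_t g"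
proof (rule poly_eqI)
  fix n
  have *: "pderiv (\<Sum>i\<le>n. F i) = (\<Sum>i\<le>n. pderiv (F i))" for F :: "nat \<Rightarrow> complex poly"
    using higher_pderiv_sum[of 1 F] by simp
  have pderiv_mult': "pderiv (p * q) = pderiv p * q + p * pderiv q" for p q :: "complex poly"
    by (simp add: pderiv_mult mult.commute)
  show "coeff (deriv_t (f * g)) n = coeff (deriv_t f * g + f * deriv_t g) n"
    by (simp add: deriv_t_def coeff_map_poly coeff_mult * pderiv_mult' sum.distrib)
qed

lemma deriv_t_lift_t: "deriv_t (lift_t p) = lift_t (pderiv p)"
  by (simp add: deriv_t_def lift_t_def map_poly_pCons)

lemma deriv_t_of_int: "deriv_t (of_int n) = 0"
  by (metis deriv_t_lift_t lift_t_of_int(1) lift_t_ring_hom(5) pderiv_singleton)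

lemma deriv_t_var_s: "deriv_t var_s = 0"
  by (simp add: deriv_t_def var_s_def map_poly_pCons)

lemma deriv_t_shift_s: "deriv_t (shift_s m f) = shift_s m (deriv_t f)"
proof (induction f)
  case 0
  show ?case by (simp add: shift_s_def deriv_t_def)
next
  case (pCons p f)
  have split: "pCons p g = lift_t p + var_s * g" for p g
    by (simp add: lift_t_def var_s_def)
  have "deriv_t (pCons p f) = pCons (pderiv p) (deriv_t f)"
    by (simp add: deriv_t_def map_poly_pCons)
  then show ?case
    by (simp add: split shift_s_ring_hom shift_s_lift_t shift_s_var_s deriv_t_add deriv_t_diff
        deriv_t_mult deriv_t_lift_t deriv_t_of_int deriv_t_var_s pCons.IH)
qed

lemma vector_space_cst_scale: "vector_space cst_scale"
  by unfold_locales (simp_all add: cst_scale_def smult_add_right smult_add_left[symmetric]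
      one_pCons[symmetric] mult.commute)

interpretation cst: vector_space cst_scale
  by (rule vector_space_cst_scale)

lemma cst_scale_lift_t: "cst_scale c f = lift_t [:c:] * f"
  by (simp add: cst_scale_def lift_t_def)

lemma smult_lift_t: "smult p f = lift_t p * f"
  by (simp add: lift_t_def)

lemma diff_quot_mult: "[:- \<alpha>, 1:] * diff_quot \<alpha> h = h - [:poly h \<alpha>:]"
  unfolding diff_quot_def by (rule dvd_mult_div_cancel) (simp add: poly_eq_0_iff_dvd[symmetric])

text \<open>
  Substituting \<open>h = h(\<alpha>) + (t - \<alpha>) g\<close> shows the common shape of the coefficients of \<open>L\<^sub>m\<close>: the factor
  \<open>t - m\<alpha>\<close> also appears in front of \<open>\<partial>\<^sub>t\<close> and in \<open>M\<^sub>m\<close>.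
\<close>
lemma h_seq_factor:
  "h_seq \<alpha> h m =
    smult (of_int m) ([:poly h \<alpha>:] + [:- (of_int m * \<alpha>), 1:] * diff_quot \<alpha> h)"
proof -
  have "h = [:poly h \<alpha>:] + [:- \<alpha>, 1:] * diff_quot \<alpha> h"
    by (simp add: diff_quot_mult del: mult_pCons_left)
  then have "h_seq \<alpha> h m = smult (of_int m) ([:poly h \<alpha>:] + [:- \<alpha>, 1:] * diff_quot \<alpha> h)
      - smult (of_int (m * (m - 1)) * \<alpha>) (diff_quot \<alpha> h)"
    unfolding h_seq_def by simp
  also have "\<dots> = smult (of_int m) ([:poly h \<alpha>:] + [:- (of_int m * \<alpha>), 1:] * diff_quot \<alpha> h)"
    by (simp add: algebra_simps smult_add_right smult_diff_right smult_diff_left)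
  finally show ?thesis .
qed


section \<open>First-order operators and the module axiom\<close>

definition first_order :: "complex \<Rightarrow> int \<Rightarrow> int \<Rightarrow> complex poly \<Rightarrow> complex poly \<Rightarrow> cst \<Rightarrow> cst" where
  "first_order lam m e u v f =
    lift_t [:lam powi m:]
      * ((of_int e * var_s + lift_t u) * shift_s m f + lift_t v * shift_s m (deriv_t f))"

lemmas operator_simps = shift_s_ring_hom shift_s_lift_t shift_s_of_int shift_s_var_s
  shift_s_shift_s deriv_t_add deriv_t_diff deriv_t_mult deriv_t_lift_t deriv_t_of_int
  deriv_t_var_s deriv_t_shift_s

lemma linear_first_order:
  "Vector_Spaces.linear cst_scale cst_scale (first_order lam m e u v)"
  by (simp add: Vector_Spaces.linear_iff vector_space_cst_scale first_order_def cst_scale_lift_t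
      operator_simps lift_t_ring_hom(5) algebra_simps)

lemma first_order_scale:
  "cst_scale (of_int k) (first_order lam m e u v f) =
    first_order lam m (k * e) (of_int k * u) (of_int k * v) f"
  by (simp add: first_order_def cst_scale_lift_t lift_t_of_int lift_t_ring_hom algebra_simps)

text \<open>
  Write the operators as \<open>\<lambda>\<^sup>m A \<sigma>\<^sup>m\<close> and \<open>\<lambda>\<^sup>n B \<sigma>\<^sup>n\<close>, where \<open>\<sigma>\<close> is the shift \<open>s \<mapsto> s - 1\<close>. Since \<open>\<sigma>\<^sup>m\<close> commutes with
  \<open>t\<close> and \<open>\<partial>\<^sub>t\<close> and satisfies \<open>\<sigma>\<^sup>m s = (s - m) \<sigma>\<^sup>m\<close>, the commutator is \<open>\<lambda>\<^sup>m\<^sup>+\<^sup>n (A (B - m e') - B (A - n e)) \<sigma>\<^sup>m\<^sup>+\<^sup>n\<close>,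
  that is, \<open>[A, B] - m e' A + n e B\<close> up to the shift. In \<open>[A, B]\<close> the terms of second order in \<open>\<partial>\<^sub>t\<close>
  cancel, as for vector fields.
\<close>
lemma commutator_first_order:
  assumes "lam \<noteq> 0"
  shows "first_order lam m e u v (first_order lam n e' u' v' f)
      - first_order lam n e' u' v' (first_order lam m e u v f) =
    first_order lam (m + n) (e * e' * (n - m))
      (v * pderiv u' - v' * pderiv u - of_int (m * e') * u + of_int (n * e) * u')
      (v * pderiv v' - v' * pderiv v - of_int (m * e') * v + of_int (n * e) * v') f"
proof -
  have powi: "lift_t [:lam powi (m + n):] = lift_t [:lam powi m:] * lift_t [:lam powi n:]"
    using assms unfolding lift_t_ring_hom(4)[symmetric] by (simp add: power_int_add mult.commute)
  have comm: "shift_s (n + m) g = shift_s (m + n) g" for g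
    by (simp add: add.commute)
  show ?thesis
    by (simp add: first_order_def powi operator_simps lift_t_ring_hom lift_t_of_int comm)
      (simp add: algebra_simps)
qed

text \<open>
  The next four functions are the data of the operator by which a basis element acts: its shift, and its
  coefficients at \<open>s\<close>, at \<open>1\<close> and at \<open>\<partial>\<^sub>t\<close>.
\<close>
fun grade :: "bms_index \<Rightarrow> int" where
  "grade (L m) = m" | "grade (M m) = m" | "grade (S m) = m" | "grade (I m) = m"

fun coeff_s :: "bms_index \<Rightarrow> int" where
  "coeff_s (L m) = 1" | "coeff_s _ = 0"

fun coeff_t :: "complex \<Rightarrow> complex \<Rightarrow> complex \<Rightarrow> complex poly \<Rightarrow> bms_index \<Rightarrow> complex poly" where
  "coeff_t \<alpha> \<beta> \<gamma> h (L m) =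
    of_int m * ([:poly h \<alpha>:] + ([:0, 1:] - of_int m * [:\<alpha>:]) * diff_quot \<alpha> h)"
| "coeff_t \<alpha> \<beta> \<gamma> h (M m) = [:0, 1:] - of_int m * [:\<alpha>:]"
| "coeff_t \<alpha> \<beta> \<gamma> h (S m) = [:\<beta>:]"
| "coeff_t \<alpha> \<beta> \<gamma> h (I m) = [:\<gamma>:] - of_int m * [:\<beta>:] * diff_quot \<alpha> h"

fun coeff_D :: "complex \<Rightarrow> complex \<Rightarrow> bms_index \<Rightarrow> complex poly" where
  "coeff_D \<alpha> \<beta> (L m) = - of_int m * ([:0, 1:] - of_int m * [:\<alpha>:])"
| "coeff_D \<alpha> \<beta> (I m) = of_int m * [:\<beta>:]"
| "coeff_D \<alpha> \<beta> _ = 0"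

lemma Phi_basis_first_order:
  "Phi_basis lam \<alpha> \<beta> \<gamma> h k f =
    first_order lam (grade k) (coeff_s k) (coeff_t \<alpha> \<beta> \<gamma> h k) (coeff_D \<alpha> \<beta> k) f"
proof -
  have mul: "lift_t [:c * d:] = lift_t [:c:] * lift_t [:d:]" for c d
    unfolding lift_t_ring_hom(4)[symmetric] by (simp add: mult.commute)
  have t: "[:- (of_int m * \<alpha>), 1:] = [:0, 1:] - of_int m * [:\<alpha>:]" for m
    by (simp add: of_int_poly mult.commute)
  have smult: "smult (of_int m) p = of_int m * p" for m and p :: "complex poly"
    by (simp add: of_int_poly)
  have s: "[:p, 1:] = var_s + lift_t p" for p
    by (simp add: var_s_def lift_t_def)
  have b: "smult (of_int m * \<beta>) p = of_int m * [:\<beta>:] * p" for m and p :: "complex poly"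
    by (simp add: of_int_poly mult.commute)
  show ?thesis
    by (cases k) (simp_all only: Phi_basis.simps grade.simps coeff_s.simps coeff_t.simps
        coeff_D.simps first_order_def cst_scale_lift_t smult_lift_t mul s h_seq_factor t smult b
        lift_t_ring_hom lift_t_of_int deriv_t_shift_s,
       simp_all only: of_int_0 of_int_1 mult_zero_left mult_1_left add_0_left add_0_right,
       simp_all add: algebra_simps)
qed

lemma Phi_single:
  "Phi lam \<alpha> \<beta> \<gamma> h (Poly_Mapping.single k c) f = cst_scale c (Phi_basis lam \<alpha> \<beta> \<gamma> h k f)"
  by (simp add: Phi_def linear_extension_single vector_space_cst_scale)

lemma linear_Phi_left: "Vector_Spaces.linear bms_scale cst_scale (\<lambda>x. Phi lam \<alpha> \<beta> \<gamma> h x f)"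
  unfolding Phi_def by (rule linear_linear_extension[OF vector_space_cst_scale])

lemma linear_Phi_right: "Vector_Spaces.linear cst_scale cst_scale (Phi lam \<alpha> \<beta> \<gamma> h x)"
proof -
  have "Vector_Spaces.linear cst_scale cst_scale (Phi_basis lam \<alpha> \<beta> \<gamma> h k)" for k
    unfolding Phi_basis_first_order[abs_def] by (rule linear_first_order)
  then show ?thesis
    by (simp add: Phi_def linear_extension_def Vector_Spaces.linear_iff cst.scale_right_distrib
      sum.distrib cst.scale_sum_right mult.commute)
qed

text \<open>
  By the commutator formula each relation is a comparison of three coefficients. Those of \<open>L\<^sub>m\<close> and \<open>I\<^sub>m\<close>
  have the form \<open>e s + const + v (\<partial>\<^sub>t - g)\<close>, with the same \<open>g = (h(t) - h(\<alpha>)) / (t - \<alpha>)\<close> throughout; this is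
  why the derivative of \<open>g\<close> cancels from \<open>[L\<^sub>m, L\<^sub>n]\<close>, \<open>[L\<^sub>m, I\<^sub>n]\<close> and \<open>[I\<^sub>m, I\<^sub>n]\<close>.
\<close>
lemma Phi_bracket_basis:
  assumes "lam \<noteq> 0"
  shows "Phi lam \<alpha> \<beta> \<gamma> h (bms_bracket_basis k l) f =
    Phi_basis lam \<alpha> \<beta> \<gamma> h k (Phi_basis lam \<alpha> \<beta> \<gamma> h l f)
    - Phi_basis lam \<alpha> \<beta> \<gamma> h l (Phi_basis lam \<alpha> \<beta> \<gamma> h k f)"
    (is "?eq k l")
proof -
  \<comment> \<open>The constants are made opaque, so that simplification treats them as ring elements and does not
    multiply out coefficient lists.\<close>
  define t a b c d g where atoms: "t = [:0, 1 :: complex:]" "a = [:\<alpha>:]" "b = [:\<beta>:]" "c = [:\<gamma>:]"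
    "d = [:poly h \<alpha>:]" "g = diff_quot \<alpha> h"
  have D: "pderiv t = 1" "pderiv a = 0" "pderiv b = 0" "pderiv c = 0" "pderiv d = 0"
    "pderiv (of_int m) = 0" for m
    by (simp_all add: atoms pderiv_pCons of_int_poly)
  have zero: "Phi lam \<alpha> \<beta> \<gamma> h 0 f = 0" "first_order lam m 0 0 0 f = 0" for m
    by (simp_all add: Phi_def linear_extension_def first_order_def lift_t_ring_hom)
  have skew: "?eq l k" if "?eq k l" for k l
    using that
    by (subst bms_bracket_basis_skew)
      (simp add: module_hom.neg[OF module_hom_linearI[OF linear_Phi_left]])
  note expand = Phi_single zero Phi_basis_first_order commutator_first_order[OF assms]
    grade.simps coeff_s.simps coeff_t.simps coeff_D.simps bms_bracket_basis.simps
    first_order_scale pderiv_add pderiv_diff pderiv_minus pderiv_mult atoms[symmetric] D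
  have cong: "first_order lam m e u v f = first_order lam m e' u' v' f"
    if "e = e'" "u = u'" "v = v'" for m e e' u u' v v'
    using that by simp
  have cong_0: "0 = first_order lam m e u v f" if "e = 0" "u = 0" "v = 0" for m e u v
    using that by (simp add: zero)
  have LL: "?eq (L m) (L n)" for m n
    unfolding expand by (intro cong; simp add: algebra_simps)
  have LM: "?eq (L m) (M n)" for m n
    unfolding expand by (intro cong; simp add: algebra_simps)
  have LS: "?eq (L m) (S n)" for m n
    unfolding expand by (intro cong; simp add: algebra_simps)
  have LI: "?eq (L m) (I n)" for m n
    unfolding expand by (intro cong; simp add: algebra_simps)
  have MI: "?eq (M m) (I n)" for m n
    unfolding expand by (intro cong; simp add: algebra_simps)
  have II: "?eq (I m) (I n)" for m n
    unfolding expand by (intro cong_0; simp add: algebra_simps)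
  have MM: "?eq (M m) (M n)" and MS: "?eq (M m) (S n)" and SS: "?eq (S m) (S n)"
    and SI: "?eq (S m) (I n)" for m n
    unfolding expand by (intro cong_0; simp add: algebra_simps)+
  show ?thesis
  proof (cases k; cases l)
  qed (simp_all only: LL LM LS LI MM MS MI SS SI II skew[OF LM] skew[OF LS] skew[OF LI] skew[OF MS]
      skew[OF MI] skew[OF SI])
qed


lemma Phi_bracket:
  assumes "lam \<noteq> 0"
  shows "Phi lam \<alpha> \<beta> \<gamma> h (bms_bracket x y) f =
    Phi lam \<alpha> \<beta> \<gamma> h x (Phi lam \<alpha> \<beta> \<gamma> h y f) - Phi lam \<alpha> \<beta> \<gamma> h y (Phi lam \<alpha> \<beta> \<gamma> h x f)"
proof -
  let ?Phi = "Phi lam \<alpha> \<beta> \<gamma> h" and ?e = "\<lambda>k::bms_index. Poly_Mapping.single k (1::complex)"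
  have Phi_simps: "?Phi (u + v) g = ?Phi u g + ?Phi v g"
      "?Phi (bms_scale c u) g = cst_scale c (?Phi u g)"
      "?Phi u (g + g') = ?Phi u g + ?Phi u g'" "?Phi u (cst_scale c g) = cst_scale c (?Phi u g)"
    for u v g g' c
    using linear_Phi_left linear_Phi_right by (simp_all add: Vector_Spaces.linear_iff)
  note linear_simps = Vector_Spaces.linear_iff vector_space_bms_scale vector_space_cst_scale
    bms_bracket_bilinear Phi_simps cst.scale_right_diff_distrib
  have basis: "?Phi (bms_bracket (?e k) y) f = ?Phi (?e k) (?Phi y f) - ?Phi y (?Phi (?e k) f)"
    for k y
  proof (rule linear_eq_on_basis[where s = cst_scale and x = y])
    show "?Phi (bms_bracket (?e k) (?e l)) f
        = ?Phi (?e k) (?Phi (?e l) f) - ?Phi (?e l) (?Phi (?e k) f)" for l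
      by (simp add: bms_bracket_single Phi_single Phi_bracket_basis[OF assms])
  qed (simp_all add: linear_simps)
  show ?thesis
    by (rule linear_eq_on_basis[where s = cst_scale and x = x])
      (simp_all add: linear_simps basis)
qed

lemma lie_module_Phi:
  assumes "lam \<noteq> 0"
  shows "lie_module bms_scale bms_bracket cst_scale (Phi lam \<alpha> \<beta> \<gamma> h)"
  by (intro lie_module.intro lie_algebra_bms vector_space_cst_scale lie_module_axioms.intro
      linear_Phi_left linear_Phi_right Phi_bracket[OF assms])

section \<open>Rigidity of isomorphisms\<close>

text \<open>
  Commuting with \<open>s\<close>, \<open>t\<close> and the scalars is commuting with all of \<open>\<complex>[s, t]\<close>, since these generate it.
\<close>
lemma additive_commuting_imp_mult:
  fixes \<phi> :: "cst \<Rightarrow> cst"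
  assumes add: "\<And>f g. \<phi> (f + g) = \<phi> f + \<phi> g"
    and scale: "\<And>c f. \<phi> (lift_t [:c:] * f) = lift_t [:c:] * \<phi> f"
    and t: "\<And>f. \<phi> (lift_t [:0, 1:] * f) = lift_t [:0, 1:] * \<phi> f"
    and s: "\<And>f. \<phi> (var_s * f) = var_s * \<phi> f"
  shows "\<phi> f = f * \<phi> 1"
proof -
  have zero: "\<phi> 0 = 0"
    using add[of 0 0] by simp
  have lift: "\<phi> (lift_t p) = lift_t p * \<phi> 1" for p
  proof (induction p)
    case 0
    show ?case by (simp add: lift_t_ring_hom zero)
  next
    case (pCons c p)
    have "lift_t (pCons c p) = lift_t [:c:] * 1 + lift_t [:0, 1:] * lift_t p"
      by (simp add: lift_t_def)
    then show ?case
      by (simp only: add scale t pCons.IH) (simp add: algebra_simps)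
  qed
  show ?thesis
  proof (induction f)
    case 0
    show ?case by (simp add: zero)
  next
    case (pCons p f)
    have "pCons p f = lift_t p + var_s * f"
      by (simp add: lift_t_def var_s_def)
    then show ?case
      by (simp only: add s lift pCons.IH) (simp add: algebra_simps)
  qed
qed

lemma cst_dvd_oneE:
  assumes "w dvd (1 :: cst)"
  obtains c where "w = lift_t [:c:]" "c \<noteq> 0"
proof -
  from assms obtain p where w: "w = [:p:]" and "p dvd 1"
    by (auto simp: is_unit_poly_iff)
  then obtain c where "p = [:c:]" "c dvd 1"
    by (auto simp: is_unit_poly_iff)
  with w show thesis
    by (intro that[of c]) (auto simp: lift_t_def)
qed

text \<open>
  For \<open>m = 1\<close> the correction term of \<open>h\<^sub>m\<close> carries the factor \<open>m (m - 1) = 0\<close>, so \<open>L\<^sub>1\<close> exhibits \<open>h\<close> itself.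
\<close>
lemma coeff_t_L_1: "coeff_t \<alpha> \<beta> \<gamma> h (L 1) = h"
  using diff_quot_mult[of \<alpha> h] by (simp del: mult_pCons_left)

text \<open>
  An isomorphism is multiplication by a nonzero constant, which commutes with both actions and
  can be cancelled.
\<close>
lemma isomorphic_imp_Phi_basis_1_eq:
  assumes iso: "lie_module_isomorphic bms_scale bms_bracket
      cst_scale (Phi lam \<alpha> \<beta> \<gamma> h) cst_scale (Phi lam' \<alpha>' \<beta>' \<gamma>' q)"
  shows "Phi_basis lam \<alpha> \<beta> \<gamma> h k 1 = Phi_basis lam' \<alpha>' \<beta>' \<gamma>' q k 1"
proof -
  from iso obtain \<phi> where lin: "Vector_Spaces.linear cst_scale cst_scale \<phi>" and "bij \<phi>"
    and hom: "\<And>x v. \<phi> (Phi lam \<alpha> \<beta> \<gamma> h x v) = Phi lam' \<alpha>' \<beta>' \<gamma>' q x (\<phi> v)"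
    unfolding lie_module_isomorphic_def by blast
  have hom_basis: "\<phi> (Phi_basis lam \<alpha> \<beta> \<gamma> h k f) = Phi_basis lam' \<alpha>' \<beta>' \<gamma>' q k (\<phi> f)" for k f
    using hom[of "Poly_Mapping.single k 1" f] by (simp add: Phi_single)
  have mult: "\<phi> f = f * \<phi> 1" for f
  proof (rule additive_commuting_imp_mult)
    show "\<phi> (var_s * f) = var_s * \<phi> f" for f
      using hom_basis[of "L 0" f]
      by (simp add: Phi_basis_first_order first_order_def shift_s_0 lift_t_ring_hom(5) lift_t_one)
    show "\<phi> (lift_t [:0, 1:] * f) = lift_t [:0, 1:] * \<phi> f" for f
      using hom_basis[of "M 0" f]
      by (simp add: Phi_basis_first_order first_order_def shift_s_0 lift_t_ring_hom(5) lift_t_one)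
  qed (use lin in \<open>simp_all add: Vector_Spaces.linear_iff flip: cst_scale_lift_t\<close>)
  obtain f where "\<phi> f = 1"
    using \<open>bij \<phi>\<close> by (metis bij_pointE)
  then have "\<phi> 1 dvd 1"
    using mult[of f] by (metis dvd_triv_right)
  then obtain c where c: "\<phi> 1 = lift_t [:c:]" "c \<noteq> 0"
    by (rule cst_dvd_oneE)
  have "Phi_basis lam \<alpha> \<beta> \<gamma> h k 1 * \<phi> 1 = Phi_basis lam' \<alpha>' \<beta>' \<gamma>' q k (cst_scale c 1)"
    by (simp only: mult[symmetric] hom_basis) (simp only: c cst_scale_lift_t mult_1_right)
  also have "\<dots> = cst_scale c (Phi_basis lam' \<alpha>' \<beta>' \<gamma>' q k 1)"
    using linear_first_order by (simp add: Phi_basis_first_order Vector_Spaces.linear_iff)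
  also have "\<dots> = Phi_basis lam' \<alpha>' \<beta>' \<gamma>' q k 1 * \<phi> 1"
    by (simp add: c cst_scale_lift_t)
  finally have "Phi_basis lam \<alpha> \<beta> \<gamma> h k 1 * \<phi> 1 = Phi_basis lam' \<alpha>' \<beta>' \<gamma>' q k 1 * \<phi> 1" .
  moreover have "\<phi> 1 \<noteq> 0"
    using c by (simp add: lift_t_def)
  ultimately show ?thesis
    by (metis mult_right_cancel)
qed

lemma Phi_basis_1:
  "Phi_basis lam \<alpha> \<beta> \<gamma> h k 1 =
    lift_t [:lam powi grade k:] * (of_int (coeff_s k) * var_s + lift_t (coeff_t \<alpha> \<beta> \<gamma> h k))"
  using shift_s_of_int[of _ 0] shift_s_of_int[of _ 1] deriv_t_of_int[of 1]
  by (simp add: Phi_basis_first_order first_order_def flip: deriv_t_shift_s)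

theorem proposition2p4:
  fixes lam lam' \<alpha> \<alpha>' \<beta> \<beta>' \<gamma> \<gamma>' :: complex and h q :: "complex poly"
  assumes "lam \<noteq> 0" and "lam' \<noteq> 0"
  shows "lie_module_isomorphic bms_scale bms_bracket
           cst_scale (Phi lam \<alpha> \<beta> \<gamma> h) cst_scale (Phi lam' \<alpha>' \<beta>' \<gamma>' q)
         \<longleftrightarrow> (lam, \<alpha>, \<beta>, \<gamma>, h) = (lam', \<alpha>', \<beta>', \<gamma>', q)"
    (is "?iso \<longleftrightarrow> ?eq")
proof
  assume ?iso
  note Phi_eq = isomorphic_imp_Phi_basis_1_eq[OF this, unfolded Phi_basis_1]
  have "lift_t ([:lam:] * coeff_t \<alpha> \<beta> \<gamma> h (M 1)) = lift_t ([:lam':] * coeff_t \<alpha>' \<beta>' \<gamma>' q (M 1))"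
    using Phi_eq[of "M 1"] by (simp add: lift_t_ring_hom(4) del: coeff_t.simps mult_pCons_left)
  then have "lam = lam'" "\<alpha> = \<alpha>'"
    using assms by (auto simp: lift_t_def)
  moreover have "\<beta> = \<beta>'"
    using Phi_eq[of "S 0"] by (simp add: lift_t_def)
  moreover have "\<gamma> = \<gamma>'"
    using Phi_eq[of "I 0"] by (simp add: lift_t_def)
  moreover have "lift_t h = lift_t q"
    using Phi_eq[of "L 1"] \<open>lam = lam'\<close> assms
    by (simp add: coeff_t_L_1 lift_t_ring_hom del: coeff_t.simps) (simp add: lift_t_def)
  ultimately show ?eq
    by (simp add: lift_t_def)
next
  assume ?eq
  moreover have "Vector_Spaces.linear cst_scale cst_scale id"
    by (simp add: Vector_Spaces.linear_iff vector_space_cst_scale)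
  ultimately show ?iso
    unfolding lie_module_isomorphic_def
    using lie_module_Phi[OF assms(1)] by (auto intro!: exI[of _ id])
qed

end
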